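(* Let $A$ be an algebra with conjugation whose scalar algebra $\operatorname{Re} A$ is an integral domain, let $(e_{A\cdot i})$ be the fixed basis of the $\operatorname{Re} A$-module $A$, with $e_{A\cdot 0}=1$, and let $F$ be the field of fractions of $\operatorname{Re} A$. Let $B$ be an $F$-algebra for which there is a linear homomorphism $(r_1,r_2)$, $r_1:\operatorname{Re} A\to F$, $r_2:A\to B$, of the $\operatorname{Re} A$-algebra $A$ into the $F$-algebra $B$ such that $r_1$ is the canonical embedding $r_1(d)=d/1$ and the elements $e_{B\cdot i}=r_2(e_{A\cdot i})$ form a basis of the $F$-vector space $B$. Then $B$ is an algebra with conjugation (with respect to the basis $(e_{B\cdot i})$), the field $F$ is the scalar algebra of $B$, and the structural constants of the $F$-algebra $B$ with respect to $(e_{B\cdot i})$ coincide with the structural constants of the $\operatorname{Re} A$-algebra $A$ with respect to $(e_{A\cdot i})$: $$C_{B\cdot ij}^{\ \ k} = C_{A\cdot ij}^{\ \ k},$$ where $d\in \operatorname{Re} A$ is identified with its image $r_1(d)\in F$.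
   Context: Algebra with conjugation (the product is not assumed associative or commutative). Let $D$ be a commutative ring and let $A$ be a $D$-algebra with unit $1$, i.e. a $D$-module with a $D$-bilinear product and a two-sided unit. Assume $A$ contains a commutative associative unital subalgebra, denoted $\operatorname{Re} A$ and called the scalar algebra of $A$, with $\operatorname{Re} A\neq A$, such that $\operatorname{Re} A$ contains the image of $D$, lies in the centre of $A$ (its elements commute and associate with all elements of $A$, so $A$ is an algebra over $\operatorname{Re} A$), and such that $A$ is a free $\operatorname{Re} A$-module with a fixed basis $(e_i)$ whose element $e_0$ is the unit $1$. Write $d=\sum_i d^i e_i$ with $d^i\in \operatorname{Re} A$. Define $\operatorname{Re} d = d^0$ (identified with $d^0\cdot 1$) and $\operatorname{Im} d = d - d^0$. The map $d\mapsto d^*=\operatorname{Re} d-\operatorname{Im} d$ is called conjugation, and $A$ is called an algebra with conjugation if $(cd)^*=d^*c^*$ for all $c,d\in A$. An $F$-algebra is an $F$-vector space with an $F$-bilinear product (not assumed associative). A linear homomorphism of a $R$-algebra $A$ into an $F$-algebra $B$ is a pair $(r_1,r_2)$ where $r_1:R\to F$ is a ring homomorphism and $r_2:A\to B$ is additive and satisfies $r_2(da)=r_1(d)r_2(a)$ and $r_2(ab)=r_2(a)r_2(b)$ for $d\in R$, $a,b\in A$. Structural constants of an algebra with respect to a basis $(e_i)$ are the coefficients $C_{ij}^{k}$ in $e_ie_j=\sum_k C_{ij}^k e_k$. The scalar algebra of $B$ being $F$ means that $F$ is identified with $F\cdot e_{B\cdot 0}\subset B$, $e_{B\cdot 0}$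 being the unit of $B$. *)

theory Defs
  imports "HOL-Algebra.Algebra"
begin

text \<open>
  An algebra is stored in the record type of modules: the fields \<open>mult\<close> and \<open>one\<close> of the
  record hold the product and the unit. The product is only bilinear, so the locale
  \<^locale>\<open>algebra\<close> of the library, which asks for a commutative ring, does not apply.
  In \<open>bilinear_algebra\<close> no unit is assumed and the field \<open>one\<close> is unconstrained.
\<close>

locale bilinear_algebra = module R M for R (structure) and M (structure) +
  assumes mult_closed:
      "\<lbrakk>x \<in> carrier M; y \<in> carrier M\<rbrakk> \<Longrightarrow> x \<otimes>\<^bsub>M\<^esub> y \<in> carrier M"
    and mult_distr_left:
      "\<lbrakk>x \<in> carrier M; y \<in> carrier M; z \<in> carrier M\<rbrakk>
       \<Longrightarrow> (x \<oplus>\<^bsub>M\<^esub> y) \<otimes>\<^bsub>M\<^esub> z = x \<otimes>\<^bsub>M\<^esub> z \<oplus>\<^bsub>M\<^esub> y \<otimes>\<^bsub>M\<^esub> z"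
    and mult_distr_right:
      "\<lbrakk>x \<in> carrier M; y \<in> carrier M; z \<in> carrier M\<rbrakk>
       \<Longrightarrow> z \<otimes>\<^bsub>M\<^esub> (x \<oplus>\<^bsub>M\<^esub> y) = z \<otimes>\<^bsub>M\<^esub> x \<oplus>\<^bsub>M\<^esub> z \<otimes>\<^bsub>M\<^esub> y"
    and mult_smult_left:
      "\<lbrakk>r \<in> carrier R; x \<in> carrier M; y \<in> carrier M\<rbrakk>
       \<Longrightarrow> (r \<odot>\<^bsub>M\<^esub> x) \<otimes>\<^bsub>M\<^esub> y = r \<odot>\<^bsub>M\<^esub> (x \<otimes>\<^bsub>M\<^esub> y)"
    and mult_smult_right:
      "\<lbrakk>r \<in> carrier R; x \<in> carrier M; y \<in> carrier M\<rbrakk>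
       \<Longrightarrow> x \<otimes>\<^bsub>M\<^esub> (r \<odot>\<^bsub>M\<^esub> y) = r \<odot>\<^bsub>M\<^esub> (x \<otimes>\<^bsub>M\<^esub> y)"

locale unital_bilinear_algebra = bilinear_algebra +
  assumes unit_closed: "\<one>\<^bsub>M\<^esub> \<in> carrier M"
    and unit_left: "x \<in> carrier M \<Longrightarrow> \<one>\<^bsub>M\<^esub> \<otimes>\<^bsub>M\<^esub> x = x"
    and unit_right: "x \<in> carrier M \<Longrightarrow> x \<otimes>\<^bsub>M\<^esub> \<one>\<^bsub>M\<^esub> = x"

text \<open>
  Bases are families \<open>(e i)\<close> indexed by an arbitrary, possibly infinite, set \<open>I\<close>. Coefficient
  families have finite support, and they are extensional (\<^const>\<open>undefined\<close> outside \<open>I\<close>) so that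
  the coefficient family of an element is unique as a function.
\<close>

definition coeff_families :: "('r, 'x) ring_scheme \<Rightarrow> 'i set \<Rightarrow> ('i \<Rightarrow> 'r) set" where
  "coeff_families R I = {c \<in> I \<rightarrow>\<^sub>E carrier R. finite {i \<in> I. c i \<noteq> \<zero>\<^bsub>R\<^esub>}}"

definition lin_comb ::
    "('r, 'x) ring_scheme \<Rightarrow> ('r, 'm, 'y) module_scheme \<Rightarrow> 'i set \<Rightarrow> ('i \<Rightarrow> 'm) \<Rightarrow> ('i \<Rightarrow> 'r) \<Rightarrow> 'm" where
  "lin_comb R M I e c = (\<Oplus>\<^bsub>M\<^esub>i\<in>{i \<in> I. c i \<noteq> \<zero>\<^bsub>R\<^esub>}. c i \<odot>\<^bsub>M\<^esub> e i)"

definition module_basis ::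
    "('r, 'x) ring_scheme \<Rightarrow> ('r, 'm, 'y) module_scheme \<Rightarrow> 'i set \<Rightarrow> ('i \<Rightarrow> 'm) \<Rightarrow> bool" where
  "module_basis R M I e \<longleftrightarrow>
     e \<in> I \<rightarrow> carrier M \<and>
     (\<forall>c\<in>coeff_families R I. lin_comb R M I e c = \<zero>\<^bsub>M\<^esub> \<longrightarrow> (\<forall>i\<in>I. c i = \<zero>\<^bsub>R\<^esub>)) \<and>
     (\<forall>x\<in>carrier M. \<exists>c\<in>coeff_families R I. x = lin_comb R M I e c)"

definition coord ::
    "('r, 'x) ring_scheme \<Rightarrow> ('r, 'm, 'y) module_scheme \<Rightarrow> 'i set \<Rightarrow> ('i \<Rightarrow> 'm) \<Rightarrow> 'm \<Rightarrow> 'i \<Rightarrow> 'r" where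
  "coord R M I e x = (THE c. c \<in> coeff_families R I \<and> x = lin_comb R M I e c)"

text \<open>\<open>structure_constant R M I e i j k\<close> is the coefficient of \<open>e k\<close> in \<open>e i \<otimes> e j\<close>.\<close>

definition structure_constant ::
    "('r, 'x) ring_scheme \<Rightarrow> ('r, 'm, 'y) module_scheme \<Rightarrow> 'i set \<Rightarrow> ('i \<Rightarrow> 'm) \<Rightarrow> 'i \<Rightarrow> 'i \<Rightarrow> 'i \<Rightarrow> 'r" where
  "structure_constant R M I e i j k = coord R M I e (e i \<otimes>\<^bsub>M\<^esub> e j) k"

text \<open>
  For a set \<open>S\<close> of scalars inside an algebra \<open>A\<close>, \<open>scalar_ring A S\<close> is \<open>S\<close> with the operations
  of \<open>A\<close>, and \<open>over_scalars A\<close> is \<open>A\<close> with its own product as scalar multiplication; the latter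
  is the \<open>S\<close>-algebra \<open>A\<close>.
\<close>

definition scalar_ring :: "('d, 'a, 'y) module_scheme \<Rightarrow> 'a set \<Rightarrow> ('d, 'a, 'y) module_scheme" where
  "scalar_ring A S = A\<lparr>carrier := S\<rparr>"

definition over_scalars :: "('d, 'a, 'y) module_scheme \<Rightarrow> ('a, 'a) module" where
  "over_scalars A =
     \<lparr>carrier = carrier A, monoid.mult = monoid.mult A, one = one A, ring.zero = ring.zero A, ring.add = ring.add A,
      smult = monoid.mult A\<rparr>"

text \<open>
  A \<open>D\<close>-algebra \<open>A\<close> with scalar algebra \<open>S\<close> (written Re \<open>A\<close> in the literature) and with the basis
  \<open>(e i)\<close> over \<open>S\<close> whose distinguished member \<open>e i\<^sub>0\<close> is the unit.
\<close>

locale algebra_with_scalars = unital_bilinear_algebra D A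
  for D (structure) and A (structure) and S and I and i\<^sub>0 and e +
  assumes scalars_subset: "S \<subset> carrier A"
    and scalars_cring: "cring (scalar_ring A S)"
    and scalars_submodule: "submodule S D A"
    and image_in_scalars: "d \<in> carrier D \<Longrightarrow> d \<odot>\<^bsub>A\<^esub> \<one>\<^bsub>A\<^esub> \<in> S"
    and scalars_commute: "\<lbrakk>s \<in> S; x \<in> carrier A\<rbrakk> \<Longrightarrow> s \<otimes>\<^bsub>A\<^esub> x = x \<otimes>\<^bsub>A\<^esub> s"
    and scalars_assoc_left:
      "\<lbrakk>s \<in> S; x \<in> carrier A; y \<in> carrier A\<rbrakk>
       \<Longrightarrow> (s \<otimes>\<^bsub>A\<^esub> x) \<otimes>\<^bsub>A\<^esub> y = s \<otimes>\<^bsub>A\<^esub> (x \<otimes>\<^bsub>A\<^esub> y)"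
    and scalars_assoc_mid:
      "\<lbrakk>s \<in> S; x \<in> carrier A; y \<in> carrier A\<rbrakk>
       \<Longrightarrow> (x \<otimes>\<^bsub>A\<^esub> s) \<otimes>\<^bsub>A\<^esub> y = x \<otimes>\<^bsub>A\<^esub> (s \<otimes>\<^bsub>A\<^esub> y)"
    and scalars_assoc_right:
      "\<lbrakk>s \<in> S; x \<in> carrier A; y \<in> carrier A\<rbrakk>
       \<Longrightarrow> (x \<otimes>\<^bsub>A\<^esub> y) \<otimes>\<^bsub>A\<^esub> s = x \<otimes>\<^bsub>A\<^esub> (y \<otimes>\<^bsub>A\<^esub> s)"
    and basis: "module_basis (scalar_ring A S) (over_scalars A) I e"
    and distinguished_index: "i\<^sub>0 \<in> I"
    and basis_unit: "e i\<^sub>0 = \<one>\<^bsub>A\<^esub>"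

definition alg_Re where
  "alg_Re A S I i\<^sub>0 e x = coord (scalar_ring A S) (over_scalars A) I e x i\<^sub>0"

definition alg_Im where
  "alg_Im A S I i\<^sub>0 e x = x \<ominus>\<^bsub>A\<^esub> alg_Re A S I i\<^sub>0 e x"

definition alg_conj where
  "alg_conj A S I i\<^sub>0 e x = alg_Re A S I i\<^sub>0 e x \<ominus>\<^bsub>A\<^esub> alg_Im A S I i\<^sub>0 e x"

locale algebra_with_conjugation = algebra_with_scalars +
  assumes conj_mult:
    "\<lbrakk>x \<in> carrier A; y \<in> carrier A\<rbrakk>
     \<Longrightarrow> alg_conj A S I i\<^sub>0 e (x \<otimes>\<^bsub>A\<^esub> y) = alg_conj A S I i\<^sub>0 e y \<otimes>\<^bsub>A\<^esub> alg_conj A S I i\<^sub>0 e x"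

text \<open>
  \<open>F\<close> is a field of fractions of the integral domain \<open>R\<close>, with canonical embedding \<open>\<iota>\<close>
  (\<open>\<iota> a = a/1\<close>); the fraction \<open>a/b\<close> is \<open>\<iota> a \<otimes> inv (\<iota> b)\<close>. The field of fractions is only
  determined up to isomorphism, so it is not tied to one construction.
\<close>

definition field_of_fractions ::
    "('r, 'x) ring_scheme \<Rightarrow> ('f, 'y) ring_scheme \<Rightarrow> ('r \<Rightarrow> 'f) \<Rightarrow> bool" where
  "field_of_fractions R F \<iota> \<longleftrightarrow>
     field F \<and> \<iota> \<in> ring_hom R F \<and> inj_on \<iota> (carrier R) \<and>
     (\<forall>f\<in>carrier F. \<exists>a\<in>carrier R. \<exists>b\<in>carrier R - {\<zero>\<^bsub>R\<^esub>}. f = \<iota> a \<otimes>\<^bsub>F\<^esub> inv\<^bsub>F\<^esub> (\<iota> b))"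

definition linear_homomorphism ::
    "('r, 'x) ring_scheme \<Rightarrow> ('r, 'a, 'y) module_scheme \<Rightarrow> ('f, 'z) ring_scheme \<Rightarrow>
     ('f, 'b, 'w) module_scheme \<Rightarrow> ('r \<Rightarrow> 'f) \<Rightarrow> ('a \<Rightarrow> 'b) \<Rightarrow> bool" where
  "linear_homomorphism R A F B r\<^sub>1 r\<^sub>2 \<longleftrightarrow>
     r\<^sub>1 \<in> ring_hom R F \<and> r\<^sub>2 \<in> carrier A \<rightarrow> carrier B \<and>
     (\<forall>x\<in>carrier A. \<forall>y\<in>carrier A. r\<^sub>2 (x \<oplus>\<^bsub>A\<^esub> y) = r\<^sub>2 x \<oplus>\<^bsub>B\<^esub> r\<^sub>2 y) \<and>
     (\<forall>d\<in>carrier R. \<forall>x\<in>carrier A. r\<^sub>2 (d \<odot>\<^bsub>A\<^esub> x) = r\<^sub>1 d \<odot>\<^bsub>B\<^esub> r\<^sub>2 x) \<and>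
     (\<forall>x\<in>carrier A. \<forall>y\<in>carrier A. r\<^sub>2 (x \<otimes>\<^bsub>A\<^esub> y) = r\<^sub>2 x \<otimes>\<^bsub>B\<^esub> r\<^sub>2 y)"

text \<open>
  The copy \<open>F \<cdot> u\<close> of \<open>F\<close> inside an \<open>F\<close>-algebra \<open>B\<close> with unit \<open>u\<close>. A unit found in an algebra
  \<open>B\<close> that was not assumed unital is recorded by \<open>B\<lparr>one := u\<rparr>\<close>.
\<close>

definition scalar_line ::
    "('f, 'z) ring_scheme \<Rightarrow> ('f, 'b, 'w) module_scheme \<Rightarrow> 'b \<Rightarrow> 'b set" where
  "scalar_line F B u = (\<lambda>f. f \<odot>\<^bsub>B\<^esub> u) ` carrier F"

end

theory Submission
  imports Defs
begin

text \<open>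
  Every element \<open>b\<close> of \<open>B\<close> is a finite combination of the \<open>r\<^sub>2 (e\<^sub>A i)\<close> with fractions as coefficients.
  Multiplying by a common denominator \<open>s\<close> gives \<open>r\<^sub>1 s \<cdot> b = r\<^sub>2 x\<close> for some \<open>x\<close> in \<open>A\<close>
  (\<open>common_denominator\<close>). So any identity between \<open>F\<close>-multilinear expressions that \<open>r\<^sub>2\<close> transports
  from \<open>A\<close> holds in \<open>B\<close> up to a nonzero factor from \<open>F\<close>, and such a factor can be cancelled
  (\<open>smult_cancel\<close>).

  Applied to the unit laws this shows that \<open>u = r\<^sub>2 1\<close> is a unit of \<open>B\<close>
  (\<open>image_of_unit_neutral\<close>). Multiplication by an element of \<open>F u\<close> is then scaling by an element of
  \<open>F\<close>, so \<open>F u\<close> is a copy of \<open>F\<close> that serves as the scalar algebra of \<open>B\<close>, and coordinates over \<open>F u\<close>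
  are coordinates over \<open>F\<close> times \<open>u\<close> (locale \<open>unit_in_basis\<close>).

  As \<open>r\<^sub>2\<close> sends the basis of \<open>A\<close> to that of \<open>B\<close>, the coordinates of \<open>r\<^sub>2 x\<close> are the images under \<open>r\<^sub>1\<close>
  of the coordinates of \<open>x\<close> (\<open>semilinear_map.coord_map\<close>). For a product of basis elements this is
  the equality of structural constants; for the coordinate at \<open>i\<^sub>0\<close> it says that \<open>r\<^sub>2\<close> preserves real
  parts and hence commutes with conjugation (\<open>map_conj\<close>). Since conjugation of \<open>B\<close> is \<open>F\<close>-linear, the
  law \<open>(bc)\<^sup>* = c\<^sup>* b\<^sup>*\<close> follows by cancelling denominators as before (\<open>conj_mult_extends\<close>).
\<close>

section \<open>Coordinates and semilinear maps\<close>

context module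
begin

lemma lin_comb_eq_finsum:
  assumes "e \<in> I \<rightarrow> carrier M" "finite J" "J \<subseteq> I" "c \<in> J \<rightarrow> carrier R"
    and "\<And>i. i \<in> I - J \<Longrightarrow> c i = \<zero>"
  shows "lin_comb R M I e c = (\<Oplus>\<^bsub>M\<^esub>i\<in>J. c i \<odot>\<^bsub>M\<^esub> e i)"
  unfolding lin_comb_def
  by (rule M.add.finprod_mono_neutral_cong_left)
    (use assms in \<open>auto simp: Pi_iff subset_iff\<close>)

text \<open>
  Extension by zero makes finite sums and coefficient families interchangeable, so that later
  arguments can work with sums over finite index sets, without extensionality side conditions.
\<close>

lemma coeff_family_of_finsum:
  fixes c
  defines "c\<^sub>0 I J \<equiv> \<lambda>i\<in>I. if i \<in> J then c i else \<zero>"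
  assumes e: "e \<in> I \<rightarrow> carrier M" and J: "finite J" "J \<subseteq> I" "c \<in> J \<rightarrow> carrier R"
  shows "c\<^sub>0 I J \<in> coeff_families R I"
    and "lin_comb R M I e (c\<^sub>0 I J) = (\<Oplus>\<^bsub>M\<^esub>i\<in>J. c i \<odot>\<^bsub>M\<^esub> e i)"
proof -
  have "{i \<in> I. c\<^sub>0 I J i \<noteq> \<zero>} \<subseteq> J" by (auto simp: c\<^sub>0_def split: if_splits)
  then show "c\<^sub>0 I J \<in> coeff_families R I"
    using J by (auto simp: coeff_families_def c\<^sub>0_def intro: finite_subset)
  have "lin_comb R M I e (c\<^sub>0 I J) = (\<Oplus>\<^bsub>M\<^esub>i\<in>J. c\<^sub>0 I J i \<odot>\<^bsub>M\<^esub> e i)"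
    by (rule lin_comb_eq_finsum) (use J e in \<open>auto simp: c\<^sub>0_def\<close>)
  also have "\<dots> = (\<Oplus>\<^bsub>M\<^esub>i\<in>J. c i \<odot>\<^bsub>M\<^esub> e i)"
    by (rule M.finsum_cong') (use J e in \<open>auto simp: c\<^sub>0_def Pi_iff subset_iff\<close>)
  finally show "lin_comb R M I e (c\<^sub>0 I J) = (\<Oplus>\<^bsub>M\<^esub>i\<in>J. c i \<odot>\<^bsub>M\<^esub> e i)" .
qed

lemma module_basisI:
  assumes e: "e \<in> I \<rightarrow> carrier M"
    and independent: "\<And>J c k. \<lbrakk>finite J; J \<subseteq> I; c \<in> J \<rightarrow> carrier R;
        (\<Oplus>\<^bsub>M\<^esub>i\<in>J. c i \<odot>\<^bsub>M\<^esub> e i) = \<zero>\<^bsub>M\<^esub>; k \<in> J\<rbrakk> \<Longrightarrow> c k = \<zero>"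
    and spanning: "\<And>x. x \<in> carrier M \<Longrightarrow>
        \<exists>J c. finite J \<and> J \<subseteq> I \<and> c \<in> J \<rightarrow> carrier R \<and> x = (\<Oplus>\<^bsub>M\<^esub>i\<in>J. c i \<odot>\<^bsub>M\<^esub> e i)"
  shows "module_basis R M I e"
  unfolding module_basis_def
proof (intro conjI ballI impI e)
  fix c k
  assume c: "c \<in> coeff_families R I" and "lin_comb R M I e c = \<zero>\<^bsub>M\<^esub>" and k: "k \<in> I"
  then show "c k = \<zero>"
    using independent[of "{i \<in> I. c i \<noteq> \<zero>}" c k]
    by (auto simp: coeff_families_def lin_comb_def)
next
  fix x assume "x \<in> carrier M"
  then obtain J c where J: "finite J" "J \<subseteq> I" "c \<in> J \<rightarrow> carrier R"
    and x: "x = (\<Oplus>\<^bsub>M\<^esub>i\<in>J. c i \<odot>\<^bsub>M\<^esub> e i)"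
    using spanning by blast
  then show "\<exists>c\<in>coeff_families R I. x = lin_comb R M I e c"
    using coeff_family_of_finsum[OF e J] by metis
qed

text \<open>The step that turns linear independence into uniqueness of coefficients.\<close>

lemma finsum_combination_diff:
  assumes "finite J" "e \<in> J \<rightarrow> carrier M" "c \<in> J \<rightarrow> carrier R" "c' \<in> J \<rightarrow> carrier R"
  shows "(\<Oplus>\<^bsub>M\<^esub>i\<in>J. (c i \<ominus> c' i) \<odot>\<^bsub>M\<^esub> e i)
    = (\<Oplus>\<^bsub>M\<^esub>i\<in>J. c i \<odot>\<^bsub>M\<^esub> e i) \<ominus>\<^bsub>M\<^esub> (\<Oplus>\<^bsub>M\<^esub>i\<in>J. c' i \<odot>\<^bsub>M\<^esub> e i)"
  using assms
proof (induct J)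
  case empty
  then show ?case by (simp add: a_minus_def M.r_neg)
next
  case (insert j J)
  have [simp]: "e j \<in> carrier M" "c j \<in> carrier R" "c' j \<in> carrier R"
    "(\<lambda>i. c i \<odot>\<^bsub>M\<^esub> e i) \<in> J \<rightarrow> carrier M" "(\<lambda>i. c' i \<odot>\<^bsub>M\<^esub> e i) \<in> J \<rightarrow> carrier M"
    "(\<lambda>i. (c i \<oplus> \<ominus> c' i) \<odot>\<^bsub>M\<^esub> e i) \<in> J \<rightarrow> carrier M"
    using insert.prems by (auto simp: Pi_iff)
  have "(\<Oplus>\<^bsub>M\<^esub>i\<in>J. (c i \<ominus> c' i) \<odot>\<^bsub>M\<^esub> e i)
    = (\<Oplus>\<^bsub>M\<^esub>i\<in>J. c i \<odot>\<^bsub>M\<^esub> e i) \<ominus>\<^bsub>M\<^esub> (\<Oplus>\<^bsub>M\<^esub>i\<in>J. c' i \<odot>\<^bsub>M\<^esub> e i)"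
    using insert by auto
  with insert(1,2) show ?case
    by (simp add: a_minus_def smult_l_distr smult_l_minus M.minus_add M.a_ac)
qed

lemma coeff_families_eqI:
  assumes basis: "module_basis R M I e"
    and c: "c \<in> coeff_families R I" and c': "c' \<in> coeff_families R I"
    and eq: "lin_comb R M I e c = lin_comb R M I e c'"
  shows "c = c'"
proof -
  have e: "e \<in> I \<rightarrow> carrier M" using basis by (simp add: module_basis_def)
  have cR: "c i \<in> carrier R" "c' i \<in> carrier R" if "i \<in> I" for i
    using that c c' by (auto simp: coeff_families_def)
  \<comment> \<open>The two supports may differ, so both sums are taken over their union.\<close>
  define J where "J = {i \<in> I. c i \<noteq> \<zero>} \<union> {i \<in> I. c' i \<noteq> \<zero>}"
  have J: "finite J" "J \<subseteq> I" using c c' by (auto simp: J_def coeff_families_def)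
  let ?d = "\<lambda>i\<in>I. c i \<ominus> c' i"
  have outside: "?d i = \<zero>" if "i \<in> I - J" for i
    using that by (auto simp: J_def a_minus_def)
  then have supp: "{i \<in> I. ?d i \<noteq> \<zero>} \<subseteq> J" by auto
  have d: "?d \<in> coeff_families R I"
    using cR finite_subset[OF supp J(1)] by (auto simp: coeff_families_def)
  have "lin_comb R M I e ?d = (\<Oplus>\<^bsub>M\<^esub>i\<in>J. ?d i \<odot>\<^bsub>M\<^esub> e i)"
    by (rule lin_comb_eq_finsum[OF e J]) (use cR J outside in auto)
  also have "\<dots> = (\<Oplus>\<^bsub>M\<^esub>i\<in>J. (c i \<ominus> c' i) \<odot>\<^bsub>M\<^esub> e i)"
    by (rule M.finsum_cong') (use cR J e in \<open>auto simp: Pi_iff subset_iff\<close>)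
  also have "\<dots> = (\<Oplus>\<^bsub>M\<^esub>i\<in>J. c i \<odot>\<^bsub>M\<^esub> e i) \<ominus>\<^bsub>M\<^esub> (\<Oplus>\<^bsub>M\<^esub>i\<in>J. c' i \<odot>\<^bsub>M\<^esub> e i)"
    by (rule finsum_combination_diff) (use cR J e in auto)
  also have "(\<Oplus>\<^bsub>M\<^esub>i\<in>J. c i \<odot>\<^bsub>M\<^esub> e i) = lin_comb R M I e c"
    by (rule lin_comb_eq_finsum[OF e J, symmetric]) (use cR J in \<open>auto simp: J_def\<close>)
  also have "(\<Oplus>\<^bsub>M\<^esub>i\<in>J. c' i \<odot>\<^bsub>M\<^esub> e i) = lin_comb R M I e c'"
    by (rule lin_comb_eq_finsum[OF e J, symmetric]) (use cR J in \<open>auto simp: J_def\<close>)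
  also have "lin_comb R M I e c \<ominus>\<^bsub>M\<^esub> lin_comb R M I e c' = \<zero>\<^bsub>M\<^esub>"
  proof -
    have "lin_comb R M I e c' \<in> carrier M"
      unfolding lin_comb_def by (rule M.finsum_closed) (use cR e in auto)
    then show ?thesis by (simp add: eq a_minus_def M.r_neg)
  qed
  finally have "\<forall>i\<in>I. ?d i = \<zero>" using basis d unfolding module_basis_def by blast
  then have "c i = c' i" if "i \<in> I" for i
    using that cR by simp
  then show ?thesis
    using c c' by (intro PiE_ext[of c I "\<lambda>_. carrier R"]) (auto simp: coeff_families_def)
qed

lemma coord_finsum:
  assumes basis: "module_basis R M I e" and J: "finite J" "J \<subseteq> I" "c \<in> J \<rightarrow> carrier R"
    and k: "k \<in> I"
  shows "coord R M I e (\<Oplus>\<^bsub>M\<^esub>i\<in>J. c i \<odot>\<^bsub>M\<^esub> e i) k = (if k \<in> J then c k else \<zero>)"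
proof -
  have e: "e \<in> I \<rightarrow> carrier M" using basis by (simp add: module_basis_def)
  let ?c = "\<lambda>i\<in>I. if i \<in> J then c i else \<zero>"
  have "coord R M I e (\<Oplus>\<^bsub>M\<^esub>i\<in>J. c i \<odot>\<^bsub>M\<^esub> e i) = ?c"
    unfolding coord_def using coeff_family_of_finsum[OF e J] coeff_families_eqI[OF basis]
    by (intro the_equality) auto
  then show ?thesis using k by simp
qed

lemma coord_expansion:
  assumes basis: "module_basis R M I e" and x: "x \<in> carrier M"
  obtains J where "finite J" "J \<subseteq> I" "coord R M I e x \<in> I \<rightarrow> carrier R"
    "\<And>i. i \<in> I - J \<Longrightarrow> coord R M I e x i = \<zero>"
    "x = (\<Oplus>\<^bsub>M\<^esub>i\<in>J. coord R M I e x i \<odot>\<^bsub>M\<^esub> e i)"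
proof -
  obtain c where c: "c \<in> coeff_families R I" "x = lin_comb R M I e c"
    using basis x by (auto simp: module_basis_def)
  then have "coord R M I e x = c"
    unfolding coord_def using coeff_families_eqI[OF basis] by (intro the_equality) auto
  then show ?thesis
    using c by (intro that[of "{i \<in> I. c i \<noteq> \<zero>}"]) (auto simp: coeff_families_def lin_comb_def)
qed

lemma coord_closed:
  "\<lbrakk>module_basis R M I e; x \<in> carrier M; k \<in> I\<rbrakk> \<Longrightarrow> coord R M I e x k \<in> carrier R"
  using coord_expansion[of I e x] by (metis PiE)

lemma coord_basis_multiple:
  assumes basis: "module_basis R M I e" and "r \<in> carrier R" "j \<in> I" "k \<in> I"
  shows "coord R M I e (r \<odot>\<^bsub>M\<^esub> e j) k = (if k = j then r else \<zero>)"
proof -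
  have "r \<odot>\<^bsub>M\<^esub> e j \<in> carrier M"
    using assms by (auto simp: module_basis_def)
  then show ?thesis
    using coord_finsum[OF basis, of "{j}" "\<lambda>_. r" k] assms by simp
qed

lemma coord_smult:
  assumes basis: "module_basis R M I e" and r: "r \<in> carrier R" and x: "x \<in> carrier M"
    and k: "k \<in> I"
  shows "coord R M I e (r \<odot>\<^bsub>M\<^esub> x) k = r \<otimes> coord R M I e x k"
proof -
  have e: "e \<in> I \<rightarrow> carrier M" using basis by (simp add: module_basis_def)
  obtain J where J: "finite J" "J \<subseteq> I" and c: "coord R M I e x \<in> I \<rightarrow> carrier R"
    and out: "\<And>i. i \<in> I - J \<Longrightarrow> coord R M I e x i = \<zero>"
    and sum: "x = (\<Oplus>\<^bsub>M\<^esub>i\<in>J. coord R M I e x i \<odot>\<^bsub>M\<^esub> e i)"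
    using coord_expansion[OF basis x] by blast
  let ?c = "coord R M I e x"
  have "r \<odot>\<^bsub>M\<^esub> x = r \<odot>\<^bsub>M\<^esub> (\<Oplus>\<^bsub>M\<^esub>i\<in>J. ?c i \<odot>\<^bsub>M\<^esub> e i)" using sum by simp
  also have "\<dots> = (\<Oplus>\<^bsub>M\<^esub>i\<in>J. r \<odot>\<^bsub>M\<^esub> (?c i \<odot>\<^bsub>M\<^esub> e i))"
    by (rule finsum_smult_ldistr[OF J(1) r]) (use J c e in auto)
  also have "\<dots> = (\<Oplus>\<^bsub>M\<^esub>i\<in>J. (r \<otimes> ?c i) \<odot>\<^bsub>M\<^esub> e i)"
    by (rule M.finsum_cong') (use J c e r in \<open>auto simp: Pi_iff subset_iff smult_assoc1\<close>)
  finally show ?thesis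
    using coord_finsum[OF basis J, of "\<lambda>i. r \<otimes> ?c i" k] J c k r out
    by (cases "k \<in> J") (simp_all add: Pi_iff subset_iff)
qed

lemma smult_cancel:
  assumes "field R" "r \<in> carrier R" "r \<noteq> \<zero>" "x \<in> carrier M" "y \<in> carrier M"
    and eq: "r \<odot>\<^bsub>M\<^esub> x = r \<odot>\<^bsub>M\<^esub> y"
  shows "x = y"
proof -
  interpret field R by fact
  have r: "r \<in> Units R" using assms field_Units by simp
  have "(inv r \<otimes> r) \<odot>\<^bsub>M\<^esub> x = (inv r \<otimes> r) \<odot>\<^bsub>M\<^esub> y"
    using assms r eq by (simp add: smult_assoc1 del: Units_l_inv)
  then show ?thesis using assms r by simp
qed

end

text \<open>
  Two kinds of map have to be followed at once, with the scalars changing as well: the given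
  homomorphism \<open>(r\<^sub>1, r\<^sub>2)\<close> from \<open>A\<close> to \<open>B\<close>, and the identity of \<open>B\<close> regarded as a map from an
  \<open>F\<close>-module to a module over the copy of \<open>F\<close> inside \<open>B\<close>. Both are additive maps \<open>h\<close> with
  \<open>h (r x) = \<sigma> r \<cdot> h x\<close>.
\<close>

locale semilinear_map = dom: module R M + cod: module R' M' for R M R' M' \<sigma> h +
  assumes scalar_map_closed: "r \<in> carrier R \<Longrightarrow> \<sigma> r \<in> carrier R'"
    and scalar_map_zero: "\<sigma> \<zero>\<^bsub>R\<^esub> = \<zero>\<^bsub>R'\<^esub>"
    and map_closed: "x \<in> carrier M \<Longrightarrow> h x \<in> carrier M'"
    and map_add: "\<lbrakk>x \<in> carrier M; y \<in> carrier M\<rbrakk> \<Longrightarrow> h (x \<oplus>\<^bsub>M\<^esub> y) = h x \<oplus>\<^bsub>M'\<^esub> h y"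
    and map_smult: "\<lbrakk>r \<in> carrier R; x \<in> carrier M\<rbrakk> \<Longrightarrow> h (r \<odot>\<^bsub>M\<^esub> x) = \<sigma> r \<odot>\<^bsub>M'\<^esub> h x"
begin

lemma additive: "abelian_group_hom M M' h"
  by (intro abelian_group_homI dom.M.abelian_group_axioms cod.M.abelian_group_axioms
      group_hom.intro group_hom_axioms.intro dom.M.add.group_axioms cod.M.add.group_axioms)
    (simp_all add: hom_def map_closed map_add)

lemma map_zero: "h \<zero>\<^bsub>M\<^esub> = \<zero>\<^bsub>M'\<^esub>"
  by (rule abelian_group_hom.hom_zero[OF additive])

lemma map_minus:
  "\<lbrakk>x \<in> carrier M; y \<in> carrier M\<rbrakk> \<Longrightarrow> h (x \<ominus>\<^bsub>M\<^esub> y) = h x \<ominus>\<^bsub>M'\<^esub> h y"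
  by (simp add: a_minus_def map_add abelian_group_hom.hom_a_inv[OF additive])

lemma map_finsum:
  assumes "finite J" "e \<in> J \<rightarrow> carrier M" "c \<in> J \<rightarrow> carrier R"
  shows "h (\<Oplus>\<^bsub>M\<^esub>i\<in>J. c i \<odot>\<^bsub>M\<^esub> e i) = (\<Oplus>\<^bsub>M'\<^esub>i\<in>J. \<sigma> (c i) \<odot>\<^bsub>M'\<^esub> h (e i))"
  using assms
proof (induct J)
  case (insert j J)
  have [simp]: "e j \<in> carrier M" "c j \<in> carrier R" "(\<lambda>i. c i \<odot>\<^bsub>M\<^esub> e i) \<in> J \<rightarrow> carrier M"
    "(\<lambda>i. \<sigma> (c i) \<odot>\<^bsub>M'\<^esub> h (e i)) \<in> J \<rightarrow> carrier M'"
    using insert.prems by (auto simp: Pi_iff scalar_map_closed map_closed)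
  have "h (\<Oplus>\<^bsub>M\<^esub>i\<in>J. c i \<odot>\<^bsub>M\<^esub> e i) = (\<Oplus>\<^bsub>M'\<^esub>i\<in>J. \<sigma> (c i) \<odot>\<^bsub>M'\<^esub> h (e i))"
    using insert by auto
  with insert(1,2) show ?case
    by (simp add: map_add map_smult scalar_map_closed map_closed)
qed (simp add: map_zero)

text \<open>
  Applying \<open>h\<close> to the expansion of \<open>x\<close> gives an expansion of \<open>h x\<close> with coefficients \<open>\<sigma> (x\<^sup>k)\<close>,
  and expansions are unique. Equality of structural constants is this lemma applied to a product
  of two basis elements.
\<close>

lemma coord_map:
  assumes basis: "module_basis R M I e" and basis': "module_basis R' M' I e'"
    and e': "\<And>i. i \<in> I \<Longrightarrow> e' i = h (e i)"
    and x: "x \<in> carrier M" and k: "k \<in> I"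
  shows "coord R' M' I e' (h x) k = \<sigma> (coord R M I e x k)"
proof -
  have e: "e \<in> I \<rightarrow> carrier M" using basis by (simp add: module_basis_def)
  let ?c = "coord R M I e x"
  obtain J where J: "finite J" "J \<subseteq> I" and c: "?c \<in> I \<rightarrow> carrier R"
    and out: "\<And>i. i \<in> I - J \<Longrightarrow> ?c i = \<zero>\<^bsub>R\<^esub>"
    and sum: "x = (\<Oplus>\<^bsub>M\<^esub>i\<in>J. ?c i \<odot>\<^bsub>M\<^esub> e i)"
    using dom.coord_expansion[OF basis x] by blast
  have "h x = h (\<Oplus>\<^bsub>M\<^esub>i\<in>J. ?c i \<odot>\<^bsub>M\<^esub> e i)" using sum by simp
  also have "\<dots> = (\<Oplus>\<^bsub>M'\<^esub>i\<in>J. \<sigma> (?c i) \<odot>\<^bsub>M'\<^esub> h (e i))"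
    by (rule map_finsum) (use J c e in auto)
  also have "\<dots> = (\<Oplus>\<^bsub>M'\<^esub>i\<in>J. \<sigma> (?c i) \<odot>\<^bsub>M'\<^esub> e' i)"
    by (rule cod.M.finsum_cong')
      (use J c e e' in \<open>auto simp: Pi_iff subset_iff scalar_map_closed map_closed\<close>)
  finally show ?thesis
    using cod.coord_finsum[OF basis' J, of "\<lambda>i. \<sigma> (?c i)" k] J c k out
    by (auto simp: scalar_map_closed scalar_map_zero Pi_iff subset_iff)
qed

end

section \<open>Algebras over their own scalars\<close>

lemma scalar_ring_simps [simp]:
  "carrier (scalar_ring A S) = S" "\<one>\<^bsub>scalar_ring A S\<^esub> = \<one>\<^bsub>A\<^esub>" "\<zero>\<^bsub>scalar_ring A S\<^esub> = \<zero>\<^bsub>A\<^esub>"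
  "x \<otimes>\<^bsub>scalar_ring A S\<^esub> y = x \<otimes>\<^bsub>A\<^esub> y" "x \<oplus>\<^bsub>scalar_ring A S\<^esub> y = x \<oplus>\<^bsub>A\<^esub> y"
  by (simp_all add: scalar_ring_def)

lemma over_scalars_simps [simp]:
  "carrier (over_scalars A) = carrier A" "\<one>\<^bsub>over_scalars A\<^esub> = \<one>\<^bsub>A\<^esub>"
  "\<zero>\<^bsub>over_scalars A\<^esub> = \<zero>\<^bsub>A\<^esub>" "x \<otimes>\<^bsub>over_scalars A\<^esub> y = x \<otimes>\<^bsub>A\<^esub> y"
  "x \<oplus>\<^bsub>over_scalars A\<^esub> y = x \<oplus>\<^bsub>A\<^esub> y" "x \<odot>\<^bsub>over_scalars A\<^esub> y = x \<otimes>\<^bsub>A\<^esub> y"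
  by (simp_all add: over_scalars_def)

text \<open>
  \<open>over_scalars\<close> forgets record fields, so the additive inverses are not syntactically the same;
  they depend only on carrier, sum and zero.
\<close>

lemma over_scalars_minus [simp]: "x \<ominus>\<^bsub>over_scalars A\<^esub> y = x \<ominus>\<^bsub>A\<^esub> y"
  by (simp add: a_minus_def a_inv_def m_inv_def)

lemma over_scalars_abelian_group:
  assumes "abelian_group M"
  shows "abelian_group (over_scalars M)"
proof -
  interpret M: abelian_group M by fact
  show ?thesis by (rule abelian_groupI) (auto simp: M.a_ac intro: M.a_inv_closed M.l_neg)
qed

lemma (in unital_bilinear_algebra) over_scalars_module:
  assumes "S \<subseteq> carrier M" "cring (scalar_ring M S)"
    and assoc: "\<And>s x y. \<lbrakk>s \<in> S; x \<in> carrier M; y \<in> carrier M\<rbrakk>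
      \<Longrightarrow> (s \<otimes>\<^bsub>M\<^esub> x) \<otimes>\<^bsub>M\<^esub> y = s \<otimes>\<^bsub>M\<^esub> (x \<otimes>\<^bsub>M\<^esub> y)"
  shows "module (scalar_ring M S) (over_scalars M)"
  by (rule moduleI)
    (use assms in \<open>auto simp: subset_iff mult_closed mult_distr_left mult_distr_right unit_left
      intro: over_scalars_abelian_group M.abelian_group_axioms\<close>)

context algebra_with_scalars
begin

lemma scalars_closed: "s \<in> S \<Longrightarrow> s \<in> carrier A"
  using scalars_subset by auto

lemma scalar_module: "module (scalar_ring A S) (over_scalars A)"
  using scalars_subset scalars_cring scalars_assoc_left by (intro over_scalars_module) auto

sublocale scal: module "scalar_ring A S" "over_scalars A"
  by (rule scalar_module)

text \<open>
  This is where properness of the scalars is used: with \<open>1\<close> as the only basis element every element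
  would be a scalar. The index set, unlike the scalars, is shared with \<open>B\<close>, so this form of
  properness survives the extension.
\<close>

lemma second_basis_index: "\<exists>i\<in>I. i \<noteq> i\<^sub>0"
proof (rule ccontr)
  assume single: "\<not> (\<exists>i\<in>I. i \<noteq> i\<^sub>0)"
  have "x \<in> S" if x: "x \<in> carrier A" for x
  proof -
    let ?c = "coord (scalar_ring A S) (over_scalars A) I e x"
    obtain J where J: "finite J" "J \<subseteq> I" and c: "?c \<in> I \<rightarrow> carrier (scalar_ring A S)"
      and sum: "x = (\<Oplus>\<^bsub>over_scalars A\<^esub>i\<in>J. ?c i \<odot>\<^bsub>over_scalars A\<^esub> e i)"
      by (rule scal.coord_expansion[OF basis, of x]) (use x in simp)
    have c0: "?c i\<^sub>0 \<in> S" using c distinguished_index by auto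
    have "J \<subseteq> {i\<^sub>0}" using single J by auto
    then consider "J = {}" | "J = {i\<^sub>0}" by blast
    then show ?thesis
    proof cases
      case 1
      then have "x = \<zero>\<^bsub>A\<^esub>" by (subst sum) simp
      then show ?thesis using scal.R.zero_closed by simp
    next
      case 2
      have "?c i\<^sub>0 \<otimes>\<^bsub>A\<^esub> e i\<^sub>0 = ?c i\<^sub>0"
        using c0 by (simp add: basis_unit unit_right scalars_closed)
      then have "x = ?c i\<^sub>0"
        using 2 c0 scalars_closed by (subst sum) simp
      then show ?thesis using c0 by simp
    qed
  qed
  then show False using scalars_subset by auto
qed

lemma alg_Re_closed: "x \<in> carrier A \<Longrightarrow> alg_Re A S I i\<^sub>0 e x \<in> S"
  using scal.coord_closed[OF basis _ distinguished_index] by (simp add: alg_Re_def)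

lemma alg_conj_closed: "x \<in> carrier A \<Longrightarrow> alg_conj A S I i\<^sub>0 e x \<in> carrier A"
  by (simp add: alg_conj_def alg_Im_def alg_Re_closed scalars_closed)

end

section \<open>Algebras with a unit among the basis elements\<close>

lemma one_update_minus [simp]:
  "\<ominus>\<^bsub>B\<lparr>one := u\<rparr>\<^esub> y = \<ominus>\<^bsub>B\<^esub> y" "x \<ominus>\<^bsub>B\<lparr>one := u\<rparr>\<^esub> y = x \<ominus>\<^bsub>B\<^esub> y"
  by (simp_all add: a_minus_def a_inv_def)

lemma (in bilinear_algebra) bilinear_algebra_one_update: "bilinear_algebra R (M\<lparr>one := u\<rparr>)"
proof -
  have "abelian_group (M\<lparr>one := u\<rparr>)"
    using M.abelian_group_axioms
    by (simp add: abelian_group_def abelian_group_axioms_def abelian_monoid_def)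
  then have "module R (M\<lparr>one := u\<rparr>)"
    by (intro moduleI)
      (simp_all add: R.is_cring smult_l_distr smult_r_distr smult_assoc1)
  then show ?thesis
    by (intro bilinear_algebra.intro bilinear_algebra_axioms.intro)
      (simp_all add: mult_closed mult_distr_left mult_distr_right mult_smult_left mult_smult_right)
qed

text \<open>
  An \<open>F\<close>-algebra with a basis that contains a two-sided unit \<open>u\<close> and some other element is an
  algebra with the line \<open>F u\<close> as its scalars.
\<close>

locale unit_in_basis = bilinear_algebra F B for F (structure) and B (structure) +
  fixes I and i\<^sub>0 and e
  assumes basis: "module_basis F B I e"
    and distinguished_index: "i\<^sub>0 \<in> I"
    and left_unit: "x \<in> carrier B \<Longrightarrow> e i\<^sub>0 \<otimes>\<^bsub>B\<^esub> x = x"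
    and right_unit: "x \<in> carrier B \<Longrightarrow> x \<otimes>\<^bsub>B\<^esub> e i\<^sub>0 = x"
    and second_index: "\<exists>i\<in>I. i \<noteq> i\<^sub>0"
    and scalars_nontrivial: "\<one>\<^bsub>F\<^esub> \<noteq> \<zero>\<^bsub>F\<^esub>"
begin

abbreviation "B' \<equiv> B\<lparr>one := e i\<^sub>0\<rparr>"
abbreviation "S \<equiv> scalar_line F B (e i\<^sub>0)"
abbreviation "\<phi> f \<equiv> f \<odot>\<^bsub>B\<^esub> e i\<^sub>0"

lemma basis_closed: "i \<in> I \<Longrightarrow> e i \<in> carrier B"
  using basis by (auto simp: module_basis_def)

lemma unit_basis_closed [simp]: "e i\<^sub>0 \<in> carrier B"
  by (rule basis_closed[OF distinguished_index])

text \<open>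
  Bilinearity and the unit laws make multiplication by \<open>f u\<close> the same as scaling by \<open>f\<close>. All the
  centrality and associativity laws of scalars, and the agreement of the two module structures
  on \<open>B\<close>, come down to this.
\<close>

lemma scalar_line_mult:
  assumes "f \<in> carrier F" "x \<in> carrier B"
  shows "\<phi> f \<otimes>\<^bsub>B\<^esub> x = f \<odot>\<^bsub>B\<^esub> x" "x \<otimes>\<^bsub>B\<^esub> \<phi> f = f \<odot>\<^bsub>B\<^esub> x"
  using assms by (simp_all add: mult_smult_left mult_smult_right left_unit right_unit)

lemma scalar_lineE:
  assumes "s \<in> S" obtains f where "f \<in> carrier F" "s = \<phi> f"
  using assms by (auto simp: scalar_line_def)

lemma scalar_line_iso: "\<phi> \<in> ring_iso F (scalar_ring B' S)"
proof -
  have "inj_on \<phi> (carrier F)"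
    by (rule inj_onI) (metis coord_basis_multiple[OF basis _ distinguished_index distinguished_index])
  then show ?thesis
    by (auto simp: ring_iso_def ring_hom_def bij_betw_def scalar_line_def smult_l_distr
        smult_assoc1 mult_smult_left left_unit)
qed

lemma scalar_line_cring: "cring (scalar_ring B' S)"
  using R.ring_iso_imp_img_cring[OF scalar_line_iso] by (simp add: scalar_ring_def)

sublocale unital: unital_bilinear_algebra F B'
  by (intro unital_bilinear_algebra.intro unital_bilinear_algebra_axioms.intro
      bilinear_algebra_one_update) (simp_all add: left_unit right_unit)

lemma scalar_line_subset: "S \<subseteq> carrier B'"
  by (auto simp: scalar_line_def)

lemma scalar_line_assoc:
  assumes "s \<in> S" "x \<in> carrier B" "y \<in> carrier B"
  shows "(s \<otimes>\<^bsub>B\<^esub> x) \<otimes>\<^bsub>B\<^esub> y = s \<otimes>\<^bsub>B\<^esub> (x \<otimes>\<^bsub>B\<^esub> y)"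
    "(x \<otimes>\<^bsub>B\<^esub> s) \<otimes>\<^bsub>B\<^esub> y = x \<otimes>\<^bsub>B\<^esub> (s \<otimes>\<^bsub>B\<^esub> y)"
    "(x \<otimes>\<^bsub>B\<^esub> y) \<otimes>\<^bsub>B\<^esub> s = x \<otimes>\<^bsub>B\<^esub> (y \<otimes>\<^bsub>B\<^esub> s)"
  using assms
  by (auto elim!: scalar_lineE
      simp: mult_smult_left mult_smult_right mult_closed left_unit right_unit)

sublocale line: semilinear_map F B "scalar_ring B' S" "over_scalars B'" \<phi> "\<lambda>x. x"
proof -
  interpret line: module "scalar_ring B' S" "over_scalars B'"
    by (rule unital.over_scalars_module)
      (use scalar_line_subset scalar_line_cring scalar_line_assoc in auto)
  show "semilinear_map F B (scalar_ring B' S) (over_scalars B') \<phi> (\<lambda>x. x)"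
    by unfold_locales (auto simp: scalar_line_def scalar_line_mult)
qed

text \<open>
  A combination with coefficients \<open>f i \<cdot> u\<close> is the combination with coefficients \<open>f i\<close> over \<open>F\<close>,
  so independence and spanning carry over.
\<close>

lemma basis_over_line: "module_basis (scalar_ring B' S) (over_scalars B') I e"
proof (rule line.cod.module_basisI)
  show "e \<in> I \<rightarrow> carrier (over_scalars B')" using basis_closed by auto
next
  fix J c k
  assume J: "finite J" "J \<subseteq> I" and c: "c \<in> J \<rightarrow> carrier (scalar_ring B' S)"
    and zero: "(\<Oplus>\<^bsub>over_scalars B'\<^esub>i\<in>J. c i \<odot>\<^bsub>over_scalars B'\<^esub> e i) = \<zero>\<^bsub>over_scalars B'\<^esub>"
    and k: "k \<in> J"
  have "\<forall>i\<in>J. \<exists>f\<in>carrier F. c i = \<phi> f" using c by (auto simp: scalar_line_def)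
  then obtain f where f: "\<And>i. i \<in> J \<Longrightarrow> f i \<in> carrier F" "\<And>i. i \<in> J \<Longrightarrow> c i = \<phi> (f i)" by metis
  have "(\<Oplus>\<^bsub>B\<^esub>i\<in>J. f i \<odot>\<^bsub>B\<^esub> e i) = (\<Oplus>\<^bsub>over_scalars B'\<^esub>i\<in>J. \<phi> (f i) \<odot>\<^bsub>over_scalars B'\<^esub> e i)"
    by (rule line.map_finsum) (use J f basis_closed in auto)
  also have "\<dots> = (\<Oplus>\<^bsub>over_scalars B'\<^esub>i\<in>J. c i \<odot>\<^bsub>over_scalars B'\<^esub> e i)"
    by (rule line.cod.M.finsum_cong')
      (use J f basis_closed in \<open>auto simp: scalar_line_mult subset_iff\<close>)
  finally have sum: "(\<Oplus>\<^bsub>B\<^esub>i\<in>J. f i \<odot>\<^bsub>B\<^esub> e i) = \<zero>\<^bsub>B\<^esub>" using zero by simp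
  have "f k = coord F B I e (\<Oplus>\<^bsub>B\<^esub>i\<in>J. f i \<odot>\<^bsub>B\<^esub> e i) k"
    using coord_finsum[OF basis J, of f k] f k J by auto
  also have "\<dots> = \<zero>\<^bsub>F\<^esub>"
    unfolding sum using coord_finsum[OF basis, of "{}" f k] J k by auto
  finally show "c k = \<zero>\<^bsub>scalar_ring B' S\<^esub>" using f k by simp
next
  fix x assume x: "x \<in> carrier (over_scalars B')"
  let ?c = "coord F B I e x"
  obtain J where J: "finite J" "J \<subseteq> I" and c: "?c \<in> I \<rightarrow> carrier F"
    and sum: "x = (\<Oplus>\<^bsub>B\<^esub>i\<in>J. ?c i \<odot>\<^bsub>B\<^esub> e i)"
    by (rule coord_expansion[OF basis, of x]) (use x in simp)
  have "x = (\<Oplus>\<^bsub>over_scalars B'\<^esub>i\<in>J. \<phi> (?c i) \<odot>\<^bsub>over_scalars B'\<^esub> e i)"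
    by (subst sum, rule line.map_finsum) (use J c basis_closed in auto)
  then show "\<exists>J c. finite J \<and> J \<subseteq> I \<and> c \<in> J \<rightarrow> carrier (scalar_ring B' S) \<and>
      x = (\<Oplus>\<^bsub>over_scalars B'\<^esub>i\<in>J. c i \<odot>\<^bsub>over_scalars B'\<^esub> e i)"
    using J c by (intro exI[of _ J] exI[of _ "\<lambda>i. \<phi> (?c i)"]) (auto simp: scalar_line_def)
qed

text \<open>
  If a second basis element were a multiple of \<open>u\<close>, its coordinate at its own index would be both
  \<open>1\<close> and \<open>0\<close>.
\<close>

lemma scalar_line_proper: "S \<noteq> carrier B"
proof
  assume eq: "S = carrier B"
  obtain i where i: "i \<in> I" "i \<noteq> i\<^sub>0" using second_index by blast
  then obtain f where f: "f \<in> carrier F" "e i = \<phi> f"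
    using eq basis_closed scalar_lineE by metis
  have "\<one>\<^bsub>F\<^esub> = coord F B I e (\<one>\<^bsub>F\<^esub> \<odot>\<^bsub>B\<^esub> e i) i"
    using coord_basis_multiple[OF basis R.one_closed i(1) i(1)] by simp
  also have "\<dots> = coord F B I e (\<phi> f) i" using f i basis_closed by simp
  also have "\<dots> = \<zero>\<^bsub>F\<^esub>"
    using coord_basis_multiple[OF basis f(1) distinguished_index i(1)] i by simp
  finally show False using scalars_nontrivial by simp
qed

lemma scalar_line_submodule: "submodule S F B'"
proof (rule unital.submoduleI)
  show "\<zero>\<^bsub>B'\<^esub> \<in> S" using line.cod.R.zero_closed by simp
  fix a assume "a \<in> S"
  then obtain f where "f \<in> carrier F" "a = \<phi> f" by (rule scalar_lineE)
  then show "\<ominus>\<^bsub>B'\<^esub> a \<in> S"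
    by (auto simp: scalar_line_def simp flip: smult_l_minus)
next
  fix a x assume "a \<in> carrier F" "x \<in> S"
  then show "a \<odot>\<^bsub>B'\<^esub> x \<in> S"
    by (auto elim!: scalar_lineE simp: scalar_line_def simp flip: smult_assoc1)
qed (use scalar_line_subset line.cod.R.add.m_closed in auto)

sublocale over_line: algebra_with_scalars F B' S I i\<^sub>0 e
proof (intro algebra_with_scalars.intro algebra_with_scalars_axioms.intro)
  show "unital_bilinear_algebra F B'" by (rule unital.unital_bilinear_algebra_axioms)
  show "S \<subset> carrier B'" using scalar_line_subset scalar_line_proper by auto
  show "s \<otimes>\<^bsub>B'\<^esub> x = x \<otimes>\<^bsub>B'\<^esub> s" if "s \<in> S" "x \<in> carrier B'" for s x
    using that by (auto elim!: scalar_lineE simp: scalar_line_mult)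
  show "f \<odot>\<^bsub>B'\<^esub> \<one>\<^bsub>B'\<^esub> \<in> S" if "f \<in> carrier F" for f
    using that by (simp add: scalar_line_def)
qed (simp_all add: scalar_line_cring scalar_line_submodule scalar_line_assoc basis_over_line
    distinguished_index)

lemma alg_Re_eq: "x \<in> carrier B \<Longrightarrow> alg_Re B' S I i\<^sub>0 e x = \<phi> (coord F B I e x i\<^sub>0)"
  using line.coord_map[OF basis basis_over_line _ _ distinguished_index]
  by (simp add: alg_Re_def)

text \<open>
  Conjugation is \<open>F\<close>-linear because the coordinate at \<open>i\<^sub>0\<close> is; thus a nonzero factor introduced to
  clear denominators passes through conjugation and can be cancelled.
\<close>

lemma alg_conj_smult:
  assumes f: "f \<in> carrier F" and x: "x \<in> carrier B"
  shows "alg_conj B' S I i\<^sub>0 e (f \<odot>\<^bsub>B\<^esub> x) = f \<odot>\<^bsub>B\<^esub> alg_conj B' S I i\<^sub>0 e x"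
proof -
  have c: "coord F B I e x i\<^sub>0 \<in> carrier F"
    by (rule coord_closed[OF basis x distinguished_index])
  have minus: "f \<odot>\<^bsub>B\<^esub> (y \<ominus>\<^bsub>B\<^esub> z) = f \<odot>\<^bsub>B\<^esub> y \<ominus>\<^bsub>B\<^esub> f \<odot>\<^bsub>B\<^esub> z"
    if "y \<in> carrier B" "z \<in> carrier B" for y z
    using that f by (simp add: a_minus_def smult_r_distr smult_r_minus)
  show ?thesis
    using f x c
    by (simp add: alg_conj_def alg_Im_def alg_Re_eq minus smult_assoc1
        coord_smult[OF basis f x distinguished_index])
qed

end

section \<open>Extension to the field of fractions\<close>

locale extension_to_fractions =
  A: algebra_with_scalars D A S I i\<^sub>0 e\<^sub>A +
  scalars: domain "scalar_ring A S" +
  B: bilinear_algebra F B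
  for D :: "('d, 'x) ring_scheme" and A :: "('d, 'a, 'y) module_scheme"
    and S :: "'a set" and I :: "'i set" and i\<^sub>0 :: 'i and e\<^sub>A :: "'i \<Rightarrow> 'a"
    and F :: "('f, 'z) ring_scheme" and B :: "('f, 'b, 'w) module_scheme" +
  fixes r\<^sub>1 :: "'a \<Rightarrow> 'f" and r\<^sub>2 :: "'a \<Rightarrow> 'b" and e\<^sub>B :: "'i \<Rightarrow> 'b"
  assumes fractions: "field_of_fractions (scalar_ring A S) F r\<^sub>1"
    and hom: "linear_homomorphism (scalar_ring A S) (over_scalars A) F B r\<^sub>1 r\<^sub>2"
    and e\<^sub>B: "i \<in> I \<Longrightarrow> e\<^sub>B i = r\<^sub>2 (e\<^sub>A i)"
    and basis: "module_basis F B I e\<^sub>B"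
begin

sublocale fld: field F
  using fractions by (simp add: field_of_fractions_def)

sublocale r: semilinear_map "scalar_ring A S" "over_scalars A" F B r\<^sub>1 r\<^sub>2
proof -
  have r1: "r\<^sub>1 \<in> ring_hom (scalar_ring A S) F" using hom by (simp add: linear_homomorphism_def)
  show "semilinear_map (scalar_ring A S) (over_scalars A) F B r\<^sub>1 r\<^sub>2"
    using hom ring_hom_zero[OF r1 A.scal.R.ring_axioms B.R.ring_axioms] ring_hom_closed[OF r1]
    by unfold_locales (auto simp: linear_homomorphism_def)
qed

lemma embedding_mult: "\<lbrakk>s \<in> S; t \<in> S\<rbrakk> \<Longrightarrow> r\<^sub>1 (s \<otimes>\<^bsub>A\<^esub> t) = r\<^sub>1 s \<otimes>\<^bsub>F\<^esub> r\<^sub>1 t"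
  using hom by (auto simp: linear_homomorphism_def ring_hom_def)

lemma embedding_one: "r\<^sub>1 \<one>\<^bsub>A\<^esub> = \<one>\<^bsub>F\<^esub>"
  using hom by (auto simp: linear_homomorphism_def ring_hom_def)

lemma embedding_closed: "s \<in> S \<Longrightarrow> r\<^sub>1 s \<in> carrier F"
  using r.scalar_map_closed by simp

lemma embedding_nonzero:
  assumes "s \<in> S" "s \<noteq> \<zero>\<^bsub>A\<^esub>" shows "r\<^sub>1 s \<noteq> \<zero>\<^bsub>F\<^esub>"
  using assms fractions r.scalar_map_zero A.scal.R.zero_closed
  unfolding field_of_fractions_def by (metis inj_on_eq_iff scalar_ring_simps(1,3))

lemma map_mult: "\<lbrakk>x \<in> carrier A; y \<in> carrier A\<rbrakk> \<Longrightarrow> r\<^sub>2 (x \<otimes>\<^bsub>A\<^esub> y) = r\<^sub>2 x \<otimes>\<^bsub>B\<^esub> r\<^sub>2 y"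
  using hom by (auto simp: linear_homomorphism_def)

lemma map_scalar_mult: "\<lbrakk>s \<in> S; x \<in> carrier A\<rbrakk> \<Longrightarrow> r\<^sub>2 (s \<otimes>\<^bsub>A\<^esub> x) = r\<^sub>1 s \<odot>\<^bsub>B\<^esub> r\<^sub>2 x"
  using hom by (auto simp: linear_homomorphism_def)

lemma map_closed: "x \<in> carrier A \<Longrightarrow> r\<^sub>2 x \<in> carrier B"
  using r.map_closed by simp

lemma coord_map:
  "\<lbrakk>x \<in> carrier A; k \<in> I\<rbrakk>
    \<Longrightarrow> coord F B I e\<^sub>B (r\<^sub>2 x) k = r\<^sub>1 (coord (scalar_ring A S) (over_scalars A) I e\<^sub>A x k)"
  using r.coord_map[OF A.basis basis e\<^sub>B] by simp

text \<open>
  \<open>s\<close> is a common denominator of the coordinates of \<open>b\<close>, expressed without coordinates.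
\<close>

definition clears_denominator :: "'a \<Rightarrow> 'b \<Rightarrow> bool" where
  "clears_denominator s b \<longleftrightarrow> s \<in> S \<and> s \<noteq> \<zero>\<^bsub>A\<^esub> \<and> r\<^sub>1 s \<odot>\<^bsub>B\<^esub> b \<in> r\<^sub>2 ` carrier A"

text \<open>
  If \<open>s b = r\<^sub>2 x\<close> and \<open>t c = r\<^sub>2 y\<close>, then \<open>s t (b + c) = r\<^sub>2 (t x + s y)\<close>; the product \<open>s t\<close> is nonzero
  since the scalars form an integral domain.
\<close>

lemma clears_denominator_add:
  assumes s: "clears_denominator s b" and t: "clears_denominator t c"
    and b: "b \<in> carrier B" and c: "c \<in> carrier B"
  shows "clears_denominator (s \<otimes>\<^bsub>A\<^esub> t) (b \<oplus>\<^bsub>B\<^esub> c)"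
proof -
  have st: "s \<in> S" "t \<in> S" "s \<noteq> \<zero>\<^bsub>A\<^esub>" "t \<noteq> \<zero>\<^bsub>A\<^esub>"
    using s t by (auto simp: clears_denominator_def)
  obtain x where x: "x \<in> carrier A" "r\<^sub>1 s \<odot>\<^bsub>B\<^esub> b = r\<^sub>2 x"
    using s by (auto simp: clears_denominator_def)
  obtain y where y: "y \<in> carrier A" "r\<^sub>1 t \<odot>\<^bsub>B\<^esub> c = r\<^sub>2 y"
    using t by (auto simp: clears_denominator_def)
  have closed: "s \<otimes>\<^bsub>A\<^esub> t \<in> S" "t \<otimes>\<^bsub>A\<^esub> x \<in> carrier A" "s \<otimes>\<^bsub>A\<^esub> y \<in> carrier A"
    using A.scal.R.m_closed[of s t] st x y by (auto simp: A.mult_closed A.scalars_closed)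
  have rst: "r\<^sub>1 s \<in> carrier F" "r\<^sub>1 t \<in> carrier F" using st embedding_closed by auto
  have "s \<otimes>\<^bsub>A\<^esub> t \<noteq> \<zero>\<^bsub>A\<^esub>"
    using scalars.integral[of s t] st by auto
  moreover have "r\<^sub>1 (s \<otimes>\<^bsub>A\<^esub> t) \<odot>\<^bsub>B\<^esub> (b \<oplus>\<^bsub>B\<^esub> c)
      = (r\<^sub>1 t \<otimes>\<^bsub>F\<^esub> r\<^sub>1 s) \<odot>\<^bsub>B\<^esub> b \<oplus>\<^bsub>B\<^esub> (r\<^sub>1 s \<otimes>\<^bsub>F\<^esub> r\<^sub>1 t) \<odot>\<^bsub>B\<^esub> c"
    using st rst b c by (simp add: embedding_mult B.smult_r_distr B.R.m_comm)
  moreover have "\<dots> = r\<^sub>1 t \<odot>\<^bsub>B\<^esub> r\<^sub>2 x \<oplus>\<^bsub>B\<^esub> r\<^sub>1 s \<odot>\<^bsub>B\<^esub> r\<^sub>2 y"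
    using rst b c x y by (simp add: B.smult_assoc1)
  moreover have "\<dots> = r\<^sub>2 (t \<otimes>\<^bsub>A\<^esub> x \<oplus>\<^bsub>A\<^esub> s \<otimes>\<^bsub>A\<^esub> y)"
    using st x y closed r.map_add[of "t \<otimes>\<^bsub>A\<^esub> x" "s \<otimes>\<^bsub>A\<^esub> y"] by (simp add: map_scalar_mult)
  ultimately show ?thesis
    using closed by (auto simp: clears_denominator_def)
qed

lemma clears_denominator_basis_multiple:
  assumes f: "f \<in> carrier F" and i: "i \<in> I"
  shows "\<exists>s. clears_denominator s (f \<odot>\<^bsub>B\<^esub> e\<^sub>B i)"
proof -
  have eA: "e\<^sub>A i \<in> carrier A" using A.basis i by (auto simp: module_basis_def)
  obtain p q where pq: "p \<in> S" "q \<in> S" "q \<noteq> \<zero>\<^bsub>A\<^esub>" and fpq: "f = r\<^sub>1 p \<otimes>\<^bsub>F\<^esub> inv\<^bsub>F\<^esub> (r\<^sub>1 q)"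
    using fractions f unfolding field_of_fractions_def by force
  have unit: "r\<^sub>1 q \<in> Units F"
    using pq embedding_nonzero embedding_closed fld.field_Units by simp
  have "r\<^sub>1 q \<otimes>\<^bsub>F\<^esub> f = r\<^sub>1 p \<otimes>\<^bsub>F\<^esub> (r\<^sub>1 q \<otimes>\<^bsub>F\<^esub> inv\<^bsub>F\<^esub> (r\<^sub>1 q))"
    using unit pq embedding_closed unfolding fpq
    by (intro B.R.m_lcomm) auto
  then have "r\<^sub>1 q \<otimes>\<^bsub>F\<^esub> f = r\<^sub>1 p"
    using unit pq embedding_closed by simp
  then have "r\<^sub>1 q \<odot>\<^bsub>B\<^esub> (f \<odot>\<^bsub>B\<^esub> e\<^sub>B i) = r\<^sub>2 (p \<otimes>\<^bsub>A\<^esub> e\<^sub>A i)"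
    using pq f i eA embedding_closed map_closed
    by (simp add: e\<^sub>B map_scalar_mult flip: B.smult_assoc1)
  then show ?thesis
    using pq eA by (auto simp: clears_denominator_def A.mult_closed A.scalars_closed)
qed

text \<open>
  Only finitely many basis elements occur in \<open>b\<close>, so denominators of the separate terms multiply
  up to a common one, also when the basis is infinite.
\<close>

lemma common_denominator:
  assumes b: "b \<in> carrier B"
  obtains s where "clears_denominator s b"
proof -
  have basis_closed: "i \<in> I \<Longrightarrow> e\<^sub>B i \<in> carrier B" for i
    using basis by (auto simp: module_basis_def)
  have "\<exists>s. clears_denominator s (\<Oplus>\<^bsub>B\<^esub>i\<in>J. c i \<odot>\<^bsub>B\<^esub> e\<^sub>B i)"
    if "finite J" "J \<subseteq> I" "c \<in> I \<rightarrow> carrier F" for J c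
    using that
  proof (induct J)
    case empty
    have "r\<^sub>1 \<one>\<^bsub>A\<^esub> \<odot>\<^bsub>B\<^esub> \<zero>\<^bsub>B\<^esub> = r\<^sub>2 \<zero>\<^bsub>A\<^esub>"
      using r.map_zero by (simp add: embedding_one)
    then have "clears_denominator \<one>\<^bsub>A\<^esub> \<zero>\<^bsub>B\<^esub>"
      using A.scal.R.one_closed scalars.one_not_zero A.zero_closed
      unfolding clears_denominator_def by (metis imageI scalar_ring_simps(1-3))
    then show ?case by auto
  next
    case (insert j J)
    then have c: "(\<lambda>i. c i \<odot>\<^bsub>B\<^esub> e\<^sub>B i) \<in> insert j J \<rightarrow> carrier B"
      using basis_closed by auto
    obtain s t where "clears_denominator s (c j \<odot>\<^bsub>B\<^esub> e\<^sub>B j)"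
      "clears_denominator t (\<Oplus>\<^bsub>B\<^esub>i\<in>J. c i \<odot>\<^bsub>B\<^esub> e\<^sub>B i)"
      using insert clears_denominator_basis_multiple[of "c j" j] by auto
    then have "clears_denominator (s \<otimes>\<^bsub>A\<^esub> t)
        (c j \<odot>\<^bsub>B\<^esub> e\<^sub>B j \<oplus>\<^bsub>B\<^esub> (\<Oplus>\<^bsub>B\<^esub>i\<in>J. c i \<odot>\<^bsub>B\<^esub> e\<^sub>B i))"
      using c by (intro clears_denominator_add) auto
    then show ?case using insert(1,2) c by auto
  qed
  moreover obtain J where "finite J" "J \<subseteq> I" "coord F B I e\<^sub>B b \<in> I \<rightarrow> carrier F"
    "b = (\<Oplus>\<^bsub>B\<^esub>i\<in>J. coord F B I e\<^sub>B b i \<odot>\<^bsub>B\<^esub> e\<^sub>B i)"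
    by (rule B.coord_expansion[OF basis b])
  ultimately show ?thesis using that by metis
qed

lemma multiple_in_image:
  assumes b: "b \<in> carrier B"
  obtains f x where "f \<in> carrier F" "f \<noteq> \<zero>\<^bsub>F\<^esub>" "x \<in> carrier A" "f \<odot>\<^bsub>B\<^esub> b = r\<^sub>2 x"
  using common_denominator[OF b] embedding_closed embedding_nonzero
  unfolding clears_denominator_def by (metis imageE)

lemma image_of_unit: "e\<^sub>B i\<^sub>0 = r\<^sub>2 \<one>\<^bsub>A\<^esub>"
  using e\<^sub>B[OF A.distinguished_index] by (simp add: A.basis_unit)

text \<open>
  \<open>B\<close> comes without a unit. On the image of \<open>r\<^sub>2\<close> the element \<open>r\<^sub>2 1\<close> is neutral by multiplicativity, and
  a nonzero multiple of every element lies in that image.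
\<close>

lemma image_of_unit_neutral:
  assumes b: "b \<in> carrier B"
  shows "e\<^sub>B i\<^sub>0 \<otimes>\<^bsub>B\<^esub> b = b" "b \<otimes>\<^bsub>B\<^esub> e\<^sub>B i\<^sub>0 = b"
proof -
  obtain f x where f: "f \<in> carrier F" "f \<noteq> \<zero>\<^bsub>F\<^esub>" and x: "x \<in> carrier A" "f \<odot>\<^bsub>B\<^esub> b = r\<^sub>2 x"
    using multiple_in_image[OF b] .
  have u: "e\<^sub>B i\<^sub>0 \<in> carrier B" by (simp add: image_of_unit map_closed A.unit_closed)
  have "f \<odot>\<^bsub>B\<^esub> (e\<^sub>B i\<^sub>0 \<otimes>\<^bsub>B\<^esub> b) = f \<odot>\<^bsub>B\<^esub> b"
    using f b u x A.unit_closed map_mult[of "\<one>\<^bsub>A\<^esub>" x]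
    by (simp add: A.unit_left image_of_unit flip: B.mult_smult_right)
  then show "e\<^sub>B i\<^sub>0 \<otimes>\<^bsub>B\<^esub> b = b"
    using B.smult_cancel[OF fld.field_axioms f] u b by (simp add: B.mult_closed)
  have "f \<odot>\<^bsub>B\<^esub> (b \<otimes>\<^bsub>B\<^esub> e\<^sub>B i\<^sub>0) = f \<odot>\<^bsub>B\<^esub> b"
    using f b u x A.unit_closed map_mult[of x "\<one>\<^bsub>A\<^esub>"]
    by (simp add: A.unit_right image_of_unit flip: B.mult_smult_left)
  then show "b \<otimes>\<^bsub>B\<^esub> e\<^sub>B i\<^sub>0 = b"
    using B.smult_cancel[OF fld.field_axioms f] u b by (simp add: B.mult_closed)
qed

sublocale ext: unit_in_basis F B I i\<^sub>0 e\<^sub>B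
  by unfold_locales
    (use basis A.distinguished_index image_of_unit_neutral A.second_basis_index fld.one_not_zero in auto)

abbreviation "conjA \<equiv> alg_conj A S I i\<^sub>0 e\<^sub>A"
abbreviation "conjB \<equiv> alg_conj (B\<lparr>one := e\<^sub>B i\<^sub>0\<rparr>) (scalar_line F B (e\<^sub>B i\<^sub>0)) I i\<^sub>0 e\<^sub>B"

text \<open>
  The real part of \<open>x\<close> is the scalar \<open>c\<close> itself, an element of \<open>A\<close>; writing it as \<open>c \<cdot> 1\<close> shows that
  \<open>r\<^sub>2 c = r\<^sub>1 c \<cdot> r\<^sub>2 1\<close>, which is the real part of \<open>r\<^sub>2 x\<close>.
\<close>

lemma map_conj:
  assumes x: "x \<in> carrier A"
  shows "r\<^sub>2 (conjA x) = conjB (r\<^sub>2 x)"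
proof -
  let ?c = "alg_Re A S I i\<^sub>0 e\<^sub>A x"
  have c: "?c \<in> S" "?c \<in> carrier A" using A.alg_Re_closed[OF x] A.scalars_closed by auto
  have "r\<^sub>2 ?c = r\<^sub>2 (?c \<otimes>\<^bsub>A\<^esub> \<one>\<^bsub>A\<^esub>)" using c by (simp add: A.unit_right)
  also have "\<dots> = r\<^sub>1 ?c \<odot>\<^bsub>B\<^esub> e\<^sub>B i\<^sub>0" using c by (simp add: map_scalar_mult A.unit_closed image_of_unit)
  also have "\<dots> = alg_Re (B\<lparr>one := e\<^sub>B i\<^sub>0\<rparr>) (scalar_line F B (e\<^sub>B i\<^sub>0)) I i\<^sub>0 e\<^sub>B (r\<^sub>2 x)"
    using coord_map[OF x A.distinguished_index] x
    by (subst ext.alg_Re_eq) (simp_all add: map_closed alg_Re_def)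
  finally have re: "r\<^sub>2 ?c = alg_Re (B\<lparr>one := e\<^sub>B i\<^sub>0\<rparr>) (scalar_line F B (e\<^sub>B i\<^sub>0)) I i\<^sub>0 e\<^sub>B (r\<^sub>2 x)" .
  have minus: "r\<^sub>2 (y \<ominus>\<^bsub>A\<^esub> z) = r\<^sub>2 y \<ominus>\<^bsub>B\<^esub> r\<^sub>2 z" if "y \<in> carrier A" "z \<in> carrier A" for y z
    using r.map_minus[of y z] that by simp
  show ?thesis using x c by (simp add: alg_conj_def alg_Im_def minus re)
qed

lemma structure_constants_map:
  assumes "i \<in> I" "j \<in> I" "k \<in> I"
  shows "structure_constant F B I e\<^sub>B i j k
    = r\<^sub>1 (structure_constant (scalar_ring A S) (over_scalars A) I e\<^sub>A i j k)"
proof -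
  have "e\<^sub>A i \<in> carrier A" "e\<^sub>A j \<in> carrier A" using assms A.basis by (auto simp: module_basis_def)
  then show ?thesis
    using assms coord_map[of "e\<^sub>A i \<otimes>\<^bsub>A\<^esub> e\<^sub>A j" k]
    by (simp add: structure_constant_def e\<^sub>B map_mult A.mult_closed)
qed

text \<open>
  With \<open>f b = r\<^sub>2 x\<close> and \<open>g c = r\<^sub>2 y\<close>, the identity for \<open>x\<close> and \<open>y\<close> in \<open>A\<close> is mapped by \<open>r\<^sub>2\<close> to the
  identity for \<open>b\<close> and \<open>c\<close> multiplied by \<open>f g\<close>, which is cancelled in the field.
\<close>

lemma conj_mult_extends:
  assumes conj_mult: "\<And>x y. \<lbrakk>x \<in> carrier A; y \<in> carrier A\<rbrakk> \<Longrightarrow> conjA (x \<otimes>\<^bsub>A\<^esub> y) = conjA y \<otimes>\<^bsub>A\<^esub> conjA x"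
    and b: "b \<in> carrier B" and c: "c \<in> carrier B"
  shows "conjB (b \<otimes>\<^bsub>B\<^esub> c) = conjB c \<otimes>\<^bsub>B\<^esub> conjB b"
proof -
  obtain f x where f: "f \<in> carrier F" "f \<noteq> \<zero>\<^bsub>F\<^esub>" and x: "x \<in> carrier A" "f \<odot>\<^bsub>B\<^esub> b = r\<^sub>2 x"
    using multiple_in_image[OF b] .
  obtain g y where g: "g \<in> carrier F" "g \<noteq> \<zero>\<^bsub>F\<^esub>" and y: "y \<in> carrier A" "g \<odot>\<^bsub>B\<^esub> c = r\<^sub>2 y"
    using multiple_in_image[OF c] .
  have conj_closed: "conjB z \<in> carrier B" if "z \<in> carrier B" for z
    using ext.over_line.alg_conj_closed[of z] that by simp
  have fg: "f \<otimes>\<^bsub>F\<^esub> g \<in> carrier F" "f \<otimes>\<^bsub>F\<^esub> g \<noteq> \<zero>\<^bsub>F\<^esub>" using f g fld.integral by auto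
  have pull: "(h \<odot>\<^bsub>B\<^esub> v) \<otimes>\<^bsub>B\<^esub> (k \<odot>\<^bsub>B\<^esub> w) = (h \<otimes>\<^bsub>F\<^esub> k) \<odot>\<^bsub>B\<^esub> (v \<otimes>\<^bsub>B\<^esub> w)"
    if "h \<in> carrier F" "k \<in> carrier F" "v \<in> carrier B" "w \<in> carrier B" for h k v w
    using that by (simp add: B.mult_smult_left B.mult_smult_right B.mult_closed B.R.m_comm
        flip: B.smult_assoc1)
  have "(f \<otimes>\<^bsub>F\<^esub> g) \<odot>\<^bsub>B\<^esub> conjB (b \<otimes>\<^bsub>B\<^esub> c) = conjB ((f \<odot>\<^bsub>B\<^esub> b) \<otimes>\<^bsub>B\<^esub> (g \<odot>\<^bsub>B\<^esub> c))"
    using f g b c fg by (simp add: pull ext.alg_conj_smult B.mult_closed)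
  also have "\<dots> = r\<^sub>2 (conjA (x \<otimes>\<^bsub>A\<^esub> y))"
    using x y by (simp add: map_mult map_conj A.mult_closed)
  also have "\<dots> = conjB (g \<odot>\<^bsub>B\<^esub> c) \<otimes>\<^bsub>B\<^esub> conjB (f \<odot>\<^bsub>B\<^esub> b)"
    using x y by (simp add: conj_mult map_mult map_conj A.alg_conj_closed)
  also have "\<dots> = (f \<otimes>\<^bsub>F\<^esub> g) \<odot>\<^bsub>B\<^esub> (conjB c \<otimes>\<^bsub>B\<^esub> conjB b)"
    using f g b c by (simp add: ext.alg_conj_smult pull conj_closed B.R.m_comm)
  finally show ?thesis
    using B.smult_cancel[OF fld.field_axioms fg] b c conj_closed by (simp add: B.mult_closed)
qed

end

theorem theorem2p1:
  fixes D :: "('d, 'x) ring_scheme" and A :: "('d, 'a, 'y) module_scheme"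
    and S :: "'a set" and I :: "'i set" and i\<^sub>0 :: 'i and e\<^sub>A :: "'i \<Rightarrow> 'a" and e\<^sub>B :: "'i \<Rightarrow> 'b"
    and F :: "('f, 'z) ring_scheme" and B :: "('f, 'b, 'w) module_scheme"
    and r\<^sub>1 :: "'a \<Rightarrow> 'f" and r\<^sub>2 :: "'a \<Rightarrow> 'b"
  assumes A: "algebra_with_conjugation D A S I i\<^sub>0 e\<^sub>A"
    and scalars_domain: "domain (scalar_ring A S)"
    and fractions: "field_of_fractions (scalar_ring A S) F r\<^sub>1"
    and B: "bilinear_algebra F B"
    and hom: "linear_homomorphism (scalar_ring A S) (over_scalars A) F B r\<^sub>1 r\<^sub>2"
    and e\<^sub>B: "\<And>i. i \<in> I \<Longrightarrow> e\<^sub>B i = r\<^sub>2 (e\<^sub>A i)"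
    and basis: "module_basis F B I e\<^sub>B"
  shows "algebra_with_conjugation F (B\<lparr>one := e\<^sub>B i\<^sub>0\<rparr>) (scalar_line F B (e\<^sub>B i\<^sub>0)) I i\<^sub>0 e\<^sub>B
    \<and> (\<lambda>f. f \<odot>\<^bsub>B\<^esub> e\<^sub>B i\<^sub>0) \<in> ring_iso F (scalar_ring (B\<lparr>one := e\<^sub>B i\<^sub>0\<rparr>) (scalar_line F B (e\<^sub>B i\<^sub>0)))
    \<and> (\<forall>i\<in>I. \<forall>j\<in>I. \<forall>k\<in>I.
         structure_constant F B I e\<^sub>B i j k
           = r\<^sub>1 (structure_constant (scalar_ring A S) (over_scalars A) I e\<^sub>A i j k))"
proof -
  interpret A: algebra_with_conjugation D A S I i\<^sub>0 e\<^sub>A by (rule A)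
  interpret extension_to_fractions D A S I i\<^sub>0 e\<^sub>A F B r\<^sub>1 r\<^sub>2 e\<^sub>B
    by (intro extension_to_fractions.intro extension_to_fractions_axioms.intro
        A.algebra_with_scalars_axioms scalars_domain B fractions hom e\<^sub>B basis)
  have "algebra_with_conjugation F (B\<lparr>one := e\<^sub>B i\<^sub>0\<rparr>) (scalar_line F B (e\<^sub>B i\<^sub>0)) I i\<^sub>0 e\<^sub>B"
    by (intro algebra_with_conjugation.intro algebra_with_conjugation_axioms.intro
        ext.over_line.algebra_with_scalars_axioms)
      (simp add: conj_mult_extends[OF A.conj_mult])
  then show ?thesis
    using ext.scalar_line_iso structure_constants_map by blast
qed

end
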